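(* Let $\mathcal G$ be a prespecified class of functions $g:\mathcal X\to\mathbb R$, and for $g\in\mathcal G$ let $$\mathcal L_p(g)=(1-p)\frac1N\sum_{i=1}^N\{Y_i(1)-g(X_i)\}^2+p\,\frac1N\sum_{i=1}^N\{Y_i(0)-g(X_i)\}^2 .$$ Then $$\operatorname*{arg\,min}_{g\in\mathcal G}\mathcal L_p(g)=\operatorname*{arg\,min}_{g\in\mathcal G}\frac1N\sum_{i=1}^N\{M_i-g(X_i)\}^2 .$$
   Context: There are $N$ units with fixed (non-random) real potential outcomes $Y_i(1),Y_i(0)$ and fixed covariate vectors $X_i\in\mathcal X\subseteq\mathbb R^K$, $i=1,\dots,N$. $N_1$ is the number of treated units, $1\le N_1\le N-1$, $p=N_1/N$, and $M_i=(1-p)Y_i(1)+pY_i(0)$. *)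

theory Defs
  imports "HOL-Analysis.Analysis"
begin

text \<open>The set of all minimizers; it is empty if the minimum is not attained on \<open>G\<close>.\<close>

definition argmin_set :: "('a \<Rightarrow> real) \<Rightarrow> 'a set \<Rightarrow> 'a set" where
  "argmin_set F G = {g. is_arg_min F (\<lambda>h. h \<in> G) g}"

text \<open>Units are indexed by \<open>1, \<dots>, N\<close>; \<open>Y1 i\<close> and \<open>Y0 i\<close> are the potential outcomes
  \<open>Y\<^sub>i(1)\<close> and \<open>Y\<^sub>i(0)\<close>.\<close>

definition weighted_loss ::
  "nat \<Rightarrow> real \<Rightarrow> (nat \<Rightarrow> real) \<Rightarrow> (nat \<Rightarrow> real) \<Rightarrow> (nat \<Rightarrow> 'x) \<Rightarrow> ('x \<Rightarrow> real) \<Rightarrow> real" where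
  "weighted_loss N p Y1 Y0 X g =
     (1 - p) * (1 / real N * (\<Sum>i=1..N. (Y1 i - g (X i))\<^sup>2))
     + p * (1 / real N * (\<Sum>i=1..N. (Y0 i - g (X i))\<^sup>2))"

definition mixed_outcome :: "real \<Rightarrow> (nat \<Rightarrow> real) \<Rightarrow> (nat \<Rightarrow> real) \<Rightarrow> nat \<Rightarrow> real" where
  "mixed_outcome p Y1 Y0 i = (1 - p) * Y1 i + p * Y0 i"

text \<open>Functions with domain exactly \<open>S\<close> are represented as elements of \<open>S \<rightarrow>\<^sub>E UNIV\<close>
  (\<open>undefined\<close> outside \<open>S\<close>), so that equality of representatives is equality on \<open>S\<close>.\<close>

abbreviation real_functions_on :: "'x set \<Rightarrow> ('x \<Rightarrow> real) set" where
  "real_functions_on S \<equiv> S \<rightarrow>\<^sub>E UNIV"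

end

theory Submission
  imports Defs
begin

text \<open>Bias-variance decomposition: \<open>(1 - p) (a - t)\<^sup>2 + p (b - t)\<^sup>2 = ((1 - p) a + p b - t)\<^sup>2 + p (1 - p) (a - b)\<^sup>2\<close>,
  so the two objectives differ by a constant independent of \<open>g\<close>.\<close>

text \<open>Minimality is decided by strict comparisons \<open>F h < F g\<close> alone, and
  \<open>c\<close> cancels from both sides.\<close>

lemma argmin_set_add_const:
  "argmin_set (\<lambda>g. F g + c) G = argmin_set F G"
  by (simp add: argmin_set_def is_arg_min_def)

lemma weighted_loss_decomp:
  "weighted_loss N p Y1 Y0 X g
   = 1 / real N * (\<Sum>i=1..N. (mixed_outcome p Y1 Y0 i - g (X i))\<^sup>2)
     + 1 / real N * (\<Sum>i=1..N. p * (1 - p) * (Y1 i - Y0 i)\<^sup>2)"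
proof -
  have "weighted_loss N p Y1 Y0 X g
      = 1 / real N * (\<Sum>i=1..N. (1 - p) * (Y1 i - g (X i))\<^sup>2 + p * (Y0 i - g (X i))\<^sup>2)"
    by (simp add: weighted_loss_def sum.distrib add_divide_distrib flip: sum_distrib_left)
  also have "(\<Sum>i=1..N. (1 - p) * (Y1 i - g (X i))\<^sup>2 + p * (Y0 i - g (X i))\<^sup>2)
      = (\<Sum>i=1..N. (mixed_outcome p Y1 Y0 i - g (X i))\<^sup>2 + p * (1 - p) * (Y1 i - Y0 i)\<^sup>2)"
    \<comment> \<open>The identity holds term by term: the weights \<open>1 - p\<close> and
      \<open>p\<close> sum to 1, so the squares of \<open>g (X i)\<close> agree, and the linear
      terms agree by the choice of \<open>mixed_outcome\<close>.\<close>
    by (intro sum.cong refl) (simp add: mixed_outcome_def power2_eq_square algebra_simps)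
  finally show ?thesis
    by (simp add: sum.distrib distrib_left add_divide_distrib)
qed

theorem proposition5:
  fixes N N1 :: nat and p :: real
    and Y1 Y0 :: "nat \<Rightarrow> real"
    and X :: "nat \<Rightarrow> real ^ 'k"
    and \<X> :: "(real ^ 'k) set"
    and G :: "(real ^ 'k \<Rightarrow> real) set"
  assumes "1 \<le> N1" and "N1 \<le> N - 1"
    and "p = real N1 / real N"
    and "\<And>i. i \<in> {1..N} \<Longrightarrow> X i \<in> \<X>"
    and "G \<subseteq> real_functions_on \<X>"
  shows "argmin_set (weighted_loss N p Y1 Y0 X) G
       = argmin_set (\<lambda>g. 1 / real N * (\<Sum>i=1..N. (mixed_outcome p Y1 Y0 i - g (X i))\<^sup>2)) G"
  \<comment> \<open>The loss occurs here unapplied, hence the abstracted equation; its last summand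
    is free of \<open>g\<close> and serves as \<open>c\<close>.\<close>
  unfolding weighted_loss_decomp [abs_def] by (rule argmin_set_add_const)

end
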